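(* Let $(M,d)$ be a (pointed) metric space. The following assertions are equivalent: (1) The norm of the Lipschitz-free space $\mathcal F(M)$ is octahedral. (2) For each $\varepsilon>0$ and each finite subset $N\subset M$ there are points $u,v\in M$, $u\neq v$, such that every $1$-Lipschitz function $f:N\to\mathbb R$ admits an extension $\tilde f:M\to\mathbb R$ which is $(1+\varepsilon)$-Lipschitz and satisfies $\tilde f(u)-\tilde f(v)\geq d(u,v)$. (3) For each finite subset $N\subseteq M$ and each $\varepsilon>0$ there exist $u,v\in M$, $u\neq v$, such that $$(1-\varepsilon)(d(x,y)+d(u,v))\leq d(x,u)+d(y,v)$$ holds for all $x,y\in N$.
   Context: All Banach spaces are real. For a metric space $M$ with a distinguished point $0$, $\mathrm{Lip}_0(M)$ is the Banach space of all real Lipschitz functions on $M$ vanishing at $0$, with norm $\|f\|=\sup\{|f(x)-f(y)|/d(x,y): x\neq y\}$. For $m\in M$ let $\delta_m\in \mathrm{Lip}_0(M)^*$ be $\delta_m(f)=f(m)$. The Lipschitz-free space is $\mathcal F(M)=\overline{\mathrm{span}}\{\delta_m:m\in M\}\subseteq \mathrm{Lip}_0(M)^*$ with the dual norm; it satisfies $\mathcal F(M)^*=\mathrm{Lip}_0(M)$. The norm of a Banach space $X$ (with unit sphere $S_X$) is octahedral if for every finite-dimensional subspace $Y\subseteq X$ and every $\varepsilon>0$ there exists $x\in S_X$ such that $\|y+\lambda x\|\geq(1-\varepsilon)(\|y\|+|\lambda|)$ for every $y\in Y$ and every $\lambda\in\mathbb R$. *)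

theory Defs
  imports "HOL-Analysis.Analysis"
begin

class pointed_metric_space = metric_space +
  fixes basepoint :: 'a

typedef (overloaded) 'a lip0 =
  "{f :: 'a::pointed_metric_space \<Rightarrow> real. f basepoint = 0 \<and> (\<exists>L. L-lipschitz_on UNIV f)}"
  morphisms lip0_apply Lip0
  by (rule exI[of _ "\<lambda>_. 0"]) (auto intro!: exI[of _ 0] lipschitz_on_constant)

setup_lifting type_definition_lip0

instantiation lip0 :: (pointed_metric_space) real_vector
begin

lift_definition zero_lip0 :: "'a lip0" is "\<lambda>_. 0"
  by (auto intro!: exI[of _ 0] lipschitz_on_constant)

lift_definition plus_lip0 :: "'a lip0 \<Rightarrow> 'a lip0 \<Rightarrow> 'a lip0" is "\<lambda>f g x. f x + g x"
  by (auto intro: lipschitz_on_add)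

lift_definition minus_lip0 :: "'a lip0 \<Rightarrow> 'a lip0 \<Rightarrow> 'a lip0" is "\<lambda>f g x. f x - g x"
  by (auto intro: lipschitz_on_diff)

lift_definition uminus_lip0 :: "'a lip0 \<Rightarrow> 'a lip0" is "\<lambda>f x. - f x"
  by (auto simp: lipschitz_on_minus)

lift_definition scaleR_lip0 :: "real \<Rightarrow> 'a lip0 \<Rightarrow> 'a lip0" is "\<lambda>c f x. c * f x"
  using lipschitz_on_cmult_real by fastforce

instance
  by standard (transfer; simp add: fun_eq_iff algebra_simps)+

end

lemma lip0_apply_simps [simp]:
  "lip0_apply 0 x = 0"
  "lip0_apply (f + g) x = lip0_apply f x + lip0_apply g x"
  "lip0_apply (f - g) x = lip0_apply f x - lip0_apply g x"
  "lip0_apply (- f) x = - lip0_apply f x"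
  "lip0_apply (c *\<^sub>R f) x = c * lip0_apply f x"
  "lip0_apply f basepoint = 0"
  by (transfer; simp)+

text \<open>In the supremum below, pairs \<open>x = y\<close> contribute \<open>0 / 0 = 0\<close>. This leaves the supremum
  over \<open>x \<noteq> y\<close> unchanged, except that it gives the intended value 0 on a one-point space.\<close>

instantiation lip0 :: (pointed_metric_space) real_normed_vector
begin

definition norm_lip0 :: "'a lip0 \<Rightarrow> real" where
  "norm_lip0 f = (SUP (x, y). \<bar>lip0_apply f x - lip0_apply f y\<bar> / dist x y)"

definition dist_lip0 :: "'a lip0 \<Rightarrow> 'a lip0 \<Rightarrow> real" where
  "dist_lip0 f g = norm (f - g)"

definition sgn_lip0 :: "'a lip0 \<Rightarrow> 'a lip0" where
  "sgn_lip0 f = f /\<^sub>R norm f"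

definition uniformity_lip0 :: "('a lip0 \<times> 'a lip0) filter" where
  "uniformity_lip0 = (INF e\<in>{0<..}. principal {(f, g). dist f g < e})"

definition open_lip0 :: "'a lip0 set \<Rightarrow> bool" where
  "open_lip0 U \<longleftrightarrow> (\<forall>f\<in>U. \<forall>\<^sub>F (f', g) in uniformity. f' = f \<longrightarrow> g \<in> U)"

lemma lip0_bdd:
  "bdd_above (range (\<lambda>(x, y). \<bar>lip0_apply f x - lip0_apply f y\<bar> / dist x y))"
proof -
  obtain L where L: "L-lipschitz_on UNIV (lip0_apply f)"
    using lip0_apply[of f] by auto
  have "\<bar>lip0_apply f x - lip0_apply f y\<bar> / dist x y \<le> L" for x y
    using lipschitz_onD[OF L, of x y] lipschitz_on_nonneg[OF L]
    by (cases "x = y") (auto simp: dist_real_def divide_simps)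
  then show ?thesis
    by (auto intro!: bdd_aboveI)
qed

lemma lip0_lipschitz: "\<bar>lip0_apply f x - lip0_apply f y\<bar> \<le> norm f * dist x y"
proof (cases "x = y")
  case False
  have "\<bar>lip0_apply f x - lip0_apply f y\<bar> / dist x y \<le> norm f"
    using cSUP_upper[OF _ lip0_bdd, of "(x, y)" f] by (simp add: norm_lip0_def)
  with False show ?thesis
    by (simp add: pos_divide_le_eq)
qed simp

lemma norm_lip0_le:
  assumes "0 \<le> C" "\<And>x y. \<bar>lip0_apply f x - lip0_apply f y\<bar> \<le> C * dist x y"
  shows "norm f \<le> C"
  unfolding norm_lip0_def
proof (rule cSUP_least)
  fix p :: "'a \<times> 'a"
  show "(case p of (x, y) \<Rightarrow> \<bar>lip0_apply f x - lip0_apply f y\<bar> / dist x y) \<le> C"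
    using assms by (cases p; cases "fst p = snd p") (auto simp: pos_divide_le_eq)
qed simp

lemma norm_lip0_nonneg: "0 \<le> norm (f :: 'a lip0)"
  using cSUP_upper[OF _ lip0_bdd, of "(basepoint, basepoint)" f] by (simp add: norm_lip0_def)

instance
proof
  fix f g :: "'a lip0" and c :: real
  show "norm f = 0 \<longleftrightarrow> f = 0"
  proof
    assume "norm f = 0"
    then have "lip0_apply f x = 0" for x
      using lip0_lipschitz[of f x basepoint] by simp
    then show "f = 0"
      by (metis ext lip0_apply_inject lip0_apply_simps(1))
  next
    assume "f = 0"
    then show "norm f = 0"
      using norm_lip0_le[of 0 f] norm_lip0_nonneg[of f] by simp
  qed
  show "norm (f + g) \<le> norm f + norm g"
  proof (rule norm_lip0_le)
    fix x y
    show "\<bar>lip0_apply (f + g) x - lip0_apply (f + g) y\<bar> \<le> (norm f + norm g) * dist x y"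
      using lip0_lipschitz[of f x y] lip0_lipschitz[of g x y]
      unfolding distrib_right lip0_apply_simps by linarith
  qed (simp add: norm_lip0_nonneg)
  have le: "norm (a *\<^sub>R h) \<le> \<bar>a\<bar> * norm h" for a and h :: "'a lip0"
  proof (rule norm_lip0_le)
    fix x y
    show "\<bar>lip0_apply (a *\<^sub>R h) x - lip0_apply (a *\<^sub>R h) y\<bar> \<le> \<bar>a\<bar> * norm h * dist x y"
      using mult_left_mono[OF lip0_lipschitz[of h x y], of "\<bar>a\<bar>"]
      by (simp add: abs_mult[symmetric] right_diff_distrib mult.assoc)
  qed (simp add: norm_lip0_nonneg)
  show "norm (c *\<^sub>R f) = \<bar>c\<bar> * norm f"
  proof (cases "c = 0")
    case True
    then show ?thesis
      using le[of 0 f] norm_lip0_nonneg[of "0 *\<^sub>R f"] by simp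
  next
    case False
    then have "\<bar>c\<bar> * norm f \<le> norm (c *\<^sub>R f)"
      using mult_left_mono[OF le[of "inverse c" "c *\<^sub>R f"], of "\<bar>c\<bar>"]
      by (simp add: mult.assoc[symmetric] abs_mult[symmetric])
    with le[of c f] show ?thesis by simp
  qed
qed (simp_all add: dist_lip0_def sgn_lip0_def uniformity_lip0_def open_lip0_def)

end

lift_definition free_delta :: "'a::pointed_metric_space \<Rightarrow> ('a lip0 \<Rightarrow>\<^sub>L real)" is
  "\<lambda>m f. lip0_apply f m"
proof (rule bounded_linear_intro)
  fix m :: 'a and f g :: "'a lip0" and c :: real
  show "norm (lip0_apply f m) \<le> norm f * dist m basepoint"
    using lip0_lipschitz[of f m basepoint] by simp
qed simp_all

definition lipschitz_free :: "('a::pointed_metric_space lip0 \<Rightarrow>\<^sub>L real) set" where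
  "lipschitz_free = closure (span (range free_delta))"

text \<open>Octahedrality is a property of a normed space; here that space is a linear subspace \<open>X\<close> of an
  ambient normed space, equipped with the restricted norm.\<close>

definition octahedral_norm_on :: "'b::real_normed_vector set \<Rightarrow> bool" where
  "octahedral_norm_on X \<longleftrightarrow>
    (\<forall>Y \<epsilon>. subspace Y \<and> (\<exists>B. finite B \<and> Y = span B) \<and> Y \<subseteq> X \<and> 0 < \<epsilon> \<longrightarrow>
      (\<exists>x\<in>X. norm x = 1 \<and>
        (\<forall>y\<in>Y. \<forall>c::real. norm (y + c *\<^sub>R x) \<ge> (1 - \<epsilon>) * (norm y + \<bar>c\<bar>))))"

end

theory Submission
  imports Defs
begin

text \<open>
  (2) implies (1): up to a small relative error, a finite-dimensional subspace of the free space
  lies in the span of the evaluations at a finite set \<open>N\<close>. A functional that almost norms an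
  element of that span only matters through its values on \<open>N\<close>, so it may be replaced by the
  extension from (2), which also almost norms the molecule \<open>(\<delta>\<^sub>u - \<delta>\<^sub>v) / d(u,v)\<close>.

  (1) implies (3): let \<open>x\<close> be octahedral for the span of the evaluations at \<open>N\<close>, and for each
  pair \<open>p\<close> of distinct points of \<open>N\<close> choose \<open>f\<^sub>p\<close> in the unit ball almost norming both the molecule
  of \<open>p\<close> and \<open>x\<close>. If (3) fails, then every difference quotient is small for at least one \<open>f\<^sub>p\<close>;
  hence the average of the \<open>f\<^sub>p\<close> has norm bounded away from 1 although \<open>x\<close> is close to 1 on it.

  (3) implies (2): take the minimum \<open>h\<close> of the McShane cones at the points of \<open>N\<close>, and cut it off
  by the cone at \<open>v\<close> with height \<open>h u - d(u,v)\<close>.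
\<close>

section \<open>Approximating finite-dimensional subspaces\<close>

text \<open>The l1 sphere of coefficient vectors is compact, and by independence the norm of the
  combination does not vanish on it; \<open>C\<close> is the reciprocal of the minimum.\<close>

lemma independent_coeff_bound:
  fixes B :: "'b::real_normed_vector set"
  assumes "finite B" "independent B"
  obtains C where "C > 0" "\<And>c. (\<Sum>b\<in>B. \<bar>c b\<bar>) \<le> C * norm (\<Sum>b\<in>B. c b *\<^sub>R b)"
proof (cases "B = {}")
  case True
  then show ?thesis using that[of 1] by simp
next
  case False
  \<comment> \<open>Coefficient functions live on the whole type; pinning them to 0 off
    \<open>B\<close> leaves a product of compact sets, so Tychonoff applies.\<close>
  define K where "K = PiE UNIV (\<lambda>b. if b \<in> B then {-1..1::real} else {0}) \<inter> {c. (\<Sum>b\<in>B. \<bar>c b\<bar>) = 1}"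
  define \<phi> where "\<phi> = (\<lambda>c. norm (\<Sum>b\<in>B. c b *\<^sub>R b))"
  have coord: "continuous_on UNIV (\<lambda>c. c b)" for b :: 'b
    using continuous_on_product_coordinates[of b] by simp
  have "compact (PiE UNIV (\<lambda>b. if b \<in> B then {-1..1::real} else {0}))"
    unfolding compactin_euclidean_iff[symmetric] euclidean_product_topology[symmetric] compactin_PiE
    by auto
  moreover have "closed {c::'b \<Rightarrow> real. (\<Sum>b\<in>B. \<bar>c b\<bar>) = 1}"
    by (intro closed_Collect_eq continuous_intros coord)
  ultimately have K: "compact K"
    unfolding K_def by (rule compact_Int_closed)
  have inK: "(\<lambda>b. if b \<in> B then c b / (\<Sum>b\<in>B. \<bar>c b\<bar>) else 0) \<in> K"
    if "(\<Sum>b\<in>B. \<bar>c b\<bar>) > 0" for c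
  proof -
    have "\<bar>c b\<bar> \<le> (\<Sum>b\<in>B. \<bar>c b\<bar>)" if "b \<in> B" for b
      using assms that by (intro member_le_sum) auto
    then have "\<bar>c b / (\<Sum>b\<in>B. \<bar>c b\<bar>)\<bar> \<le> 1" if "b \<in> B" for b
      using \<open>_ > 0\<close> that by (simp add: divide_simps)
    then have "-1 \<le> c b / (\<Sum>b\<in>B. \<bar>c b\<bar>)" "c b / (\<Sum>b\<in>B. \<bar>c b\<bar>) \<le> 1" if "b \<in> B" for b
      using that unfolding abs_le_iff by (metis minus_le_iff)+
    moreover have "(\<Sum>b\<in>B. \<bar>if b \<in> B then c b / (\<Sum>b\<in>B. \<bar>c b\<bar>) else 0\<bar>) = 1"
      using that by (simp flip: sum_divide_distrib)
    ultimately show ?thesis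
      unfolding K_def by (auto simp del: abs_divide)
  qed
  obtain b0 where "b0 \<in> B" using False by auto
  have "(\<Sum>b\<in>B. \<bar>(\<lambda>b. if b = b0 then 1 else 0::real) b\<bar>) = (\<Sum>b\<in>B. if b = b0 then 1 else 0)"
    by (intro sum.cong) auto
  then have "K \<noteq> {}"
    using inK[of "\<lambda>b. if b = b0 then 1 else 0"] \<open>b0 \<in> B\<close> assms by auto
  moreover have "continuous_on K \<phi>"
    unfolding \<phi>_def
    by (intro continuous_intros continuous_on_subset[OF coord]) auto
  ultimately obtain c0 where c0: "c0 \<in> K" "\<And>c. c \<in> K \<Longrightarrow> \<phi> c0 \<le> \<phi> c"
    using continuous_attains_inf[OF K] by metis
  have "\<phi> c0 \<noteq> 0"
  proof
    assume "\<phi> c0 = 0"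
    then have "c0 b = 0" if "b \<in> B" for b
      using assms that unfolding \<phi>_def norm_eq_zero dependent_finite[OF assms(1)] by blast
    then show False
      using c0(1) by (simp add: K_def)
  qed
  then have pos: "\<phi> c0 > 0" by (simp add: \<phi>_def)
  show ?thesis
  proof (rule that[of "1 / \<phi> c0"])
    fix c :: "'b \<Rightarrow> real"
    define s where "s = (\<Sum>b\<in>B. \<bar>c b\<bar>)"
    show "(\<Sum>b\<in>B. \<bar>c b\<bar>) \<le> 1 / \<phi> c0 * norm (\<Sum>b\<in>B. c b *\<^sub>R b)"
    proof (cases "s > 0")
      case True
      have "\<phi> c0 \<le> \<phi> (\<lambda>b. if b \<in> B then c b / s else 0)"
        using c0(2) inK True unfolding s_def by blast
      also have "\<dots> = norm ((1 / s) *\<^sub>R (\<Sum>b\<in>B. c b *\<^sub>R b))"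
        unfolding \<phi>_def by (simp add: scaleR_sum_right cong: sum.cong)
      also have "\<dots> = norm (\<Sum>b\<in>B. c b *\<^sub>R b) / s"
        using True by simp
      finally show ?thesis
        using True pos by (simp add: field_simps flip: s_def)
    next
      case False
      moreover have "0 \<le> 1 / \<phi> c0 * norm (\<Sum>b\<in>B. c b *\<^sub>R b)"
        using pos by simp
      ultimately show ?thesis unfolding s_def by linarith
    qed
  qed (use pos in simp)
qed

text \<open>It suffices to approximate a basis: the coefficients of \<open>y\<close> are bounded by
  a multiple of \<open>norm y\<close>, so the error is relative to \<open>norm y\<close>.\<close>

lemma finite_dim_approx_span:
  fixes B D :: "'b::real_normed_vector set"
  assumes "finite B" "B \<subseteq> closure (span D)" "\<eta> > 0"
  obtains F where "finite F" "F \<subseteq> D"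
    "\<And>y. y \<in> span B \<Longrightarrow> \<exists>z\<in>span F. norm (y - z) \<le> \<eta> * norm y"
proof -
  obtain B' where B': "B' \<subseteq> B" "independent B'" "B \<subseteq> span B'"
    using maximal_independent_subset by metis
  have fin: "finite B'" using B' assms finite_subset by blast
  obtain C where C: "C > 0" "\<And>c. (\<Sum>b\<in>B'. \<bar>c b\<bar>) \<le> C * norm (\<Sum>b\<in>B'. c b *\<^sub>R b)"
    using independent_coeff_bound[OF fin B'(2)] by metis
  \<comment> \<open>The tolerance \<open>\<eta> / C\<close> cancels the constant of the coefficient
    bound.\<close>
  have "\<exists>s T. finite T \<and> T \<subseteq> D \<and> s \<in> span T \<and> norm (b - s) \<le> \<eta> / C" if "b \<in> B'" for b
  proof -
    have "b \<in> closure (span D)" using that B' assms by blast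
    then obtain s where s: "s \<in> span D" "dist s b < \<eta> / C"
      using assms C(1) unfolding closure_approachable by (meson divide_pos_pos)
    obtain T r where T: "finite T" "T \<subseteq> D" "s = (\<Sum>a\<in>T. r a *\<^sub>R a)"
      using s(1) unfolding span_explicit by auto
    have "s \<in> span T" unfolding T(3)
      by (intro span_sum span_scale span_base)
    then show ?thesis
      using T s(2) by (metis dist_commute dist_norm less_imp_le)
  qed
  then obtain s T where sT: "\<And>b. b \<in> B' \<Longrightarrow>
      finite (T b) \<and> T b \<subseteq> D \<and> s b \<in> span (T b) \<and> norm (b - s b) \<le> \<eta> / C"
    by metis
  show ?thesis
  proof (rule that[of "\<Union>b\<in>B'. T b"])
    fix y assume "y \<in> span B"
    then have "y \<in> span B'"
      using B'(3) span_minimal[OF _ subspace_span] by blast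
    then obtain c where y: "y = (\<Sum>b\<in>B'. c b *\<^sub>R b)"
      unfolding span_finite[OF fin] by auto
    have mem: "(\<Sum>b\<in>B'. c b *\<^sub>R s b) \<in> span (\<Union>b\<in>B'. T b)"
      using sT span_mono[of "T _" "\<Union>b\<in>B'. T b"] by (intro span_sum span_scale) blast
    have "norm (y - (\<Sum>b\<in>B'. c b *\<^sub>R s b)) = norm (\<Sum>b\<in>B'. c b *\<^sub>R (b - s b))"
      by (simp add: y scaleR_diff_right sum_subtractf)
    also have "\<dots> \<le> (\<Sum>b\<in>B'. \<bar>c b\<bar> * (\<eta> / C))"
      using sT by (intro sum_norm_le) (simp add: mult_left_mono del: times_divide_eq_right)
    also have "\<dots> = (\<Sum>b\<in>B'. \<bar>c b\<bar>) * (\<eta> / C)"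
      by (rule sum_distrib_right[symmetric])
    also have "\<dots> \<le> (C * norm y) * (\<eta> / C)"
      using C assms unfolding y by (intro mult_right_mono) auto
    also have "\<dots> = \<eta> * norm y" using C(1) by simp
    finally show "\<exists>z\<in>span (\<Union>b\<in>B'. T b). norm (y - z) \<le> \<eta> * norm y"
      using mem by blast
  qed (use fin sT in auto)
qed

section \<open>Functionals on the space of Lipschitz functions\<close>

lemma free_delta_apply [simp]: "blinfun_apply (free_delta m) f = lip0_apply f m"
  by (simp add: free_delta.rep_eq)

lemma blinfun_norm_approx:
  fixes T :: "'b::real_normed_vector \<Rightarrow>\<^sub>L real"
  assumes "r < norm T" "0 \<le> r"
  obtains f where "norm f \<le> 1" "r < blinfun_apply T f"
proof -
  have "\<not> (\<forall>f. norm (blinfun_apply T f) \<le> r * norm f)"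
    using norm_blinfun_bound[of r T] assms by auto
  then obtain f where f: "r * norm f < \<bar>blinfun_apply T f\<bar>"
    by (auto simp: not_le)
  have "f \<noteq> 0" using f by auto
  \<comment> \<open>The sign makes the value positive, so that no absolute value is left in the
    conclusion.\<close>
  define g where "g = (sgn (blinfun_apply T f) / norm f) *\<^sub>R f"
  have "norm g \<le> 1"
    using \<open>f \<noteq> 0\<close> by (auto simp: g_def sgn_real_def)
  moreover have "r < blinfun_apply T g"
    using f \<open>f \<noteq> 0\<close>
    by (simp add: g_def blinfun.scaleR_right field_simps sgn_real_def abs_if split: if_splits)
  ultimately show ?thesis by (rule that)
qed

lemma blinfun_apply_le:
  fixes T :: "'b::real_normed_vector \<Rightarrow>\<^sub>L real"
  shows "blinfun_apply T f \<le> norm T * norm f"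
  using norm_blinfun[of T f] by simp

text \<open>This allows an almost norming function to be exchanged for any other one with the same
  values on \<open>N\<close>.\<close>

lemma span_free_delta_cong:
  assumes "z \<in> span (free_delta ` N)" "\<And>x. x \<in> N \<Longrightarrow> lip0_apply f x = lip0_apply g x"
  shows "blinfun_apply z f = blinfun_apply z g"
  using assms(1)
  by (induction rule: span_induct_alt)
    (use assms(2) in \<open>auto simp: blinfun.add_left blinfun.scaleR_left\<close>)

section \<open>Cones and normalisation at the base point\<close>

lemma lipschitz_on_cone:
  fixes a L :: real and p :: "'b::metric_space"
  assumes "0 \<le> L"
  shows "L-lipschitz_on X (\<lambda>z. a + L * dist p z)"
proof (rule lipschitz_onI)
  fix x y
  have "\<bar>dist p x - dist p y\<bar> \<le> dist x y"
    by (metis abs_dist_diff_le dist_commute)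
  then have "L * \<bar>dist p x - dist p y\<bar> \<le> L * dist x y"
    using assms by (rule mult_left_mono)
  then show "dist (a + L * dist p x) (a + L * dist p y) \<le> L * dist x y"
    using assms by (simp add: dist_real_def abs_mult flip: right_diff_distrib)
qed fact

text \<open>Subtracting the value at the base point changes no difference, so the Lipschitz constant
  still bounds the norm.\<close>

lemma lip0_of_lipschitz:
  fixes g :: "'a::pointed_metric_space \<Rightarrow> real"
  assumes "L-lipschitz_on UNIV g"
  obtains h where "norm h \<le> L" "\<And>x. lip0_apply h x = g x - g basepoint"
proof -
  have L: "L-lipschitz_on UNIV (\<lambda>x. g x - g basepoint)"
    using lipschitz_on_diff[OF assms lipschitz_on_constant[of UNIV "g basepoint"]] by simp
  then have h: "lip0_apply (Lip0 (\<lambda>x. g x - g basepoint)) x = g x - g basepoint" for x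
    by (subst Lip0_inverse) auto
  have "norm (Lip0 (\<lambda>x. g x - g basepoint)) \<le> L"
    using lipschitz_on_nonneg[OF assms] lipschitz_onD[OF assms]
    by (intro norm_lip0_le) (auto simp: h dist_real_def)
  with h show ?thesis using that by blast
qed

lemma lip0_apply_sum: "lip0_apply (\<Sum>i\<in>I. f i) x = (\<Sum>i\<in>I. lip0_apply (f i) x)"
  by (induction I rule: infinite_finite_induct) auto

section \<open>Molecules\<close>

definition molecule :: "'a::pointed_metric_space \<Rightarrow> 'a \<Rightarrow> 'a lip0 \<Rightarrow>\<^sub>L real" where
  "molecule u v = (free_delta u - free_delta v) /\<^sub>R dist u v"

lemma molecule_apply:
  "blinfun_apply (molecule u v) f = (lip0_apply f u - lip0_apply f v) / dist u v"
  by (simp add: molecule_def blinfun.scaleR_left blinfun.diff_left divide_inverse mult.commute)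

lemma molecule_in_span:
  "u \<in> N \<Longrightarrow> v \<in> N \<Longrightarrow> molecule u v \<in> span (free_delta ` N)"
  unfolding molecule_def by (intro span_scale span_diff span_base imageI)

text \<open>The Lipschitz estimate gives the upper bound; the distance from \<open>v\<close>,
  shifted to vanish at the base point, attains it.\<close>

lemma norm_molecule:
  assumes "u \<noteq> v"
  shows "norm (molecule u v) = 1"
proof (rule antisym)
  show "norm (molecule u v) \<le> 1"
  proof (rule norm_blinfun_bound)
    show "norm (blinfun_apply (molecule u v) f) \<le> 1 * norm f" for f
      using lip0_lipschitz[of f u v] assms by (simp add: molecule_apply divide_simps)
  qed simp
  have "1-lipschitz_on UNIV (\<lambda>z. dist v z)"
    using lipschitz_on_cone[of 1 UNIV 0 v] by simp
  then obtain h where h: "norm h \<le> 1" "\<And>x. lip0_apply h x = dist v x - dist v basepoint"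
    using lip0_of_lipschitz by metis
  have "1 = blinfun_apply (molecule u v) h"
    using assms by (simp add: molecule_apply h dist_commute)
  also have "\<dots> \<le> norm (molecule u v) * norm h" by (rule blinfun_apply_le)
  also have "\<dots> \<le> norm (molecule u v)"
    using h(1) by (simp add: mult_left_le)
  finally show "1 \<le> norm (molecule u v)" .
qed

section \<open>Octahedrality, extensions and distances\<close>

text \<open>For \<open>c \<ge> 0\<close>, the extension of an almost norming function of
  \<open>z\<close> keeps its value at \<open>z\<close>, is at least 1 on the molecule, and has norm
  at most \<open>1 + e\<close>, whence the factor.\<close>

lemma norm_add_molecule_ge:
  fixes N :: "'a::pointed_metric_space set"
  assumes "u \<noteq> v" "0 < e" "basepoint \<in> N"
    and ext: "\<And>f :: 'a \<Rightarrow> real. 1-lipschitz_on N f \<Longrightarrow>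
        \<exists>g. (\<forall>x\<in>N. g x = f x) \<and> (1 + e)-lipschitz_on UNIV g \<and> dist u v \<le> g u - g v"
    and z: "z \<in> span (free_delta ` N)"
  shows "norm z + \<bar>c\<bar> \<le> (1 + e) * norm (z + c *\<^sub>R molecule u v)"
proof -
  have nonneg: "norm z + c \<le> (1 + e) * norm (z + c *\<^sub>R molecule u v)"
    if z: "z \<in> span (free_delta ` N)" and "c \<ge> 0" for z c
  proof -
    let ?r = "(1 + e) * norm (z + c *\<^sub>R molecule u v) - c"
    have le: "blinfun_apply z f \<le> ?r" if "norm f \<le> 1" for f
    proof -
      have "1-lipschitz_on N (lip0_apply f)"
      proof (rule lipschitz_onI)
        show "dist (lip0_apply f x) (lip0_apply f y) \<le> 1 * dist x y" for x y
          using lip0_lipschitz[of f x y] mult_right_mono[OF that, of "dist x y"]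
          by (simp add: dist_real_def)
      qed simp
      then obtain g where g: "\<forall>x\<in>N. g x = lip0_apply f x" "(1 + e)-lipschitz_on UNIV g"
          "dist u v \<le> g u - g v"
        using ext by blast
      obtain h where h: "norm h \<le> 1 + e" "\<And>x. lip0_apply h x = g x - g basepoint"
        using lip0_of_lipschitz[OF g(2)] by metis
      \<comment> \<open>Since the base point lies in \<open>N\<close>, \<open>g\<close> vanishes
        there, so \<open>h\<close> agrees with \<open>g\<close>, hence with \<open>f\<close>, on
        \<open>N\<close>.\<close>
      have "blinfun_apply z f = blinfun_apply z h"
        using g(1) \<open>basepoint \<in> N\<close> by (intro span_free_delta_cong[OF z]) (simp add: h)
      moreover have "1 \<le> blinfun_apply (molecule u v) h"
        using g(3) \<open>u \<noteq> v\<close> by (simp add: molecule_apply h)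
      ultimately have "blinfun_apply z f + c \<le> blinfun_apply (z + c *\<^sub>R molecule u v) h"
        using mult_left_mono[of 1 "blinfun_apply (molecule u v) h" c] \<open>c \<ge> 0\<close>
        by (simp add: blinfun.add_left blinfun.scaleR_left)
      also have "\<dots> \<le> norm (z + c *\<^sub>R molecule u v) * norm h" by (rule blinfun_apply_le)
      also have "\<dots> \<le> norm (z + c *\<^sub>R molecule u v) * (1 + e)"
        using h(1) by (intro mult_left_mono) auto
      finally show ?thesis by (simp add: mult.commute)
    qed
    \<comment> \<open>The approximation of \<open>norm z\<close> by values needs a nonnegative
      threshold.\<close>
    have "0 \<le> ?r" using le[of 0] by simp
    have "norm z \<le> ?r"
    proof (rule ccontr)
      assume "\<not> ?thesis"
      then have "?r < norm z" by simp
      then obtain f where "norm f \<le> 1" "?r < blinfun_apply z f"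
        using \<open>0 \<le> ?r\<close> by (rule blinfun_norm_approx)
      with le[of f] show False by simp
    qed
    then show ?thesis by simp
  qed
  show ?thesis
  proof (cases "c \<ge> 0")
    case True
    then show ?thesis using nonneg[OF z] by simp
  next
    case False
    \<comment> \<open>Negative \<open>c\<close> reduces to the case above by changing the sign of
      the whole vector.\<close>
    have "norm (- z + (- c) *\<^sub>R molecule u v) = norm (z + c *\<^sub>R molecule u v)"
      by (metis minus_add_distrib norm_minus_cancel scaleR_minus_left)
    then show ?thesis
      using nonneg[of "- z" "- c"] z False by (simp add: span_neg)
  qed
qed

text \<open>The octahedral direction is the molecule of the points supplied by the extension
  property.\<close>

lemma octahedral_of_extension:
  assumes ext: "\<And>(e::real) (N :: 'a::pointed_metric_space set). 0 < e \<Longrightarrow> finite N \<Longrightarrow>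
      \<exists>u v. u \<noteq> v \<and> (\<forall>f :: 'a \<Rightarrow> real. 1-lipschitz_on N f \<longrightarrow>
        (\<exists>g. (\<forall>x\<in>N. g x = f x) \<and> (1 + e)-lipschitz_on UNIV g \<and> g u - g v \<ge> dist u v))"
  shows "octahedral_norm_on (lipschitz_free :: ('a lip0 \<Rightarrow>\<^sub>L real) set)"
  unfolding octahedral_norm_on_def
proof (intro allI impI, elim conjE exE)
  fix Y B :: "('a lip0 \<Rightarrow>\<^sub>L real) set" and \<epsilon> :: real
  assume Y: "finite B" "Y = span B" "Y \<subseteq> lipschitz_free" and "0 < \<epsilon>"
  \<comment> \<open>One \<open>\<eta>\<close> pays for the factor \<open>1 + \<eta>\<close>, two for
    passing between \<open>y\<close> and \<open>z\<close>: once in \<open>norm z\<close>, once in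
    the norm of the sum.\<close>
  define \<eta> where "\<eta> = min \<epsilon> 1 / 3"
  have \<eta>: "0 < \<eta>" "3 * \<eta> \<le> \<epsilon>" "\<eta> < 1" using \<open>0 < \<epsilon>\<close> by (auto simp: \<eta>_def)
  have "B \<subseteq> closure (span (range free_delta))"
    using Y span_superset[of B] unfolding lipschitz_free_def by blast
  then obtain F where F: "finite F" "F \<subseteq> range free_delta"
      "\<And>y. y \<in> Y \<Longrightarrow> \<exists>z\<in>span F. norm (y - z) \<le> \<eta> * norm y"
    using finite_dim_approx_span[OF Y(1) _ \<eta>(1)] Y(2) by metis
  then obtain N0 where N0: "finite N0" "F = free_delta ` N0"
    using finite_subset_image by metis
  define N where "N = insert basepoint N0"
  have N: "finite N" "basepoint \<in> N" and sub: "span F \<subseteq> span (free_delta ` N)"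
    using N0 by (auto simp: N_def intro!: span_mono)
  obtain u v where uv: "u \<noteq> v" "\<And>f :: 'a \<Rightarrow> real. 1-lipschitz_on N f \<Longrightarrow>
        \<exists>g. (\<forall>x\<in>N. g x = f x) \<and> (1 + \<eta>)-lipschitz_on UNIV g \<and> dist u v \<le> g u - g v"
    using ext[OF \<eta>(1) N(1)] by metis
  show "\<exists>x\<in>lipschitz_free. norm x = 1 \<and>
      (\<forall>y\<in>Y. \<forall>c. (1 - \<epsilon>) * (norm y + \<bar>c\<bar>) \<le> norm (y + c *\<^sub>R x))"
  proof (intro bexI conjI ballI allI)
    fix y and c :: real
    assume "y \<in> Y"
    then obtain z where z: "z \<in> span F" "norm (y - z) \<le> \<eta> * norm y" using F(3) by blast
    define R where "R = norm (z + c *\<^sub>R molecule u v)"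
    have "norm z + \<bar>c\<bar> \<le> (1 + \<eta>) * R"
      unfolding R_def using z(1) sub norm_add_molecule_ge[OF uv(1) \<eta>(1) N(2) uv(2)] by blast
    \<comment> \<open>As \<open>(1 - \<eta>) * (1 + \<eta>) \<le> 1\<close>, this moves the factor
      to the left side.\<close>
    then have "(1 - \<eta>) * (norm z + \<bar>c\<bar>) \<le> (1 - \<eta>) * ((1 + \<eta>) * R)"
      using \<eta> by (intro mult_left_mono) auto
    also have "\<dots> = R - \<eta>\<^sup>2 * R" by (simp add: algebra_simps power2_eq_square)
    also have "\<dots> \<le> R" by (simp add: R_def)
    finally have 1: "(1 - \<eta>) * (norm z + \<bar>c\<bar>) \<le> R" .
    have 2: "R \<le> norm (y + c *\<^sub>R molecule u v) + norm (y - z)"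
      unfolding R_def using norm_triangle_ineq4[of "y + c *\<^sub>R molecule u v" "y - z"]
      by (simp add: algebra_simps)
    have "norm y - \<eta> * norm y \<le> norm z"
      using z(2) norm_triangle_ineq2[of y z] by linarith
    then have "(1 - \<eta>) * (norm y - \<eta> * norm y + \<bar>c\<bar>) \<le> (1 - \<eta>) * (norm z + \<bar>c\<bar>)"
      using \<eta> by (intro mult_left_mono) auto
    moreover have "(1 - \<eta>) * (norm y - \<eta> * norm y + \<bar>c\<bar>)
        = (1 - 3 * \<eta>) * (norm y + \<bar>c\<bar>) + \<eta> * norm y + \<eta>\<^sup>2 * norm y + 2 * (\<eta> * \<bar>c\<bar>)"
      by (simp add: algebra_simps power2_eq_square)
    moreover have "0 \<le> \<eta>\<^sup>2 * norm y" "0 \<le> \<eta> * \<bar>c\<bar>" using \<eta> by auto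
    moreover have "(1 - \<epsilon>) * (norm y + \<bar>c\<bar>) \<le> (1 - 3 * \<eta>) * (norm y + \<bar>c\<bar>)"
      using \<eta> by (intro mult_right_mono) auto
    ultimately show "(1 - \<epsilon>) * (norm y + \<bar>c\<bar>) \<le> norm (y + c *\<^sub>R molecule u v)"
      using 1 2 z(2) by linarith
  next
    show "norm (molecule u v) = 1" by (rule norm_molecule[OF uv(1)])
    show "molecule u v \<in> lipschitz_free"
      unfolding lipschitz_free_def
      by (rule subsetD[OF closure_subset]) (rule molecule_in_span; simp)
  qed
qed

text \<open>The averaging is done with the plain sum \<open>g\<close>: failure gives
  \<open>norm g \<le> card P - \<epsilon>\<close>, yet the functional \<open>x\<close> of norm 1
  exceeds this value at \<open>g\<close>.\<close>

lemma distance_of_octahedral: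
  fixes N :: "'a::pointed_metric_space set" and \<epsilon> :: real
  assumes oct: "octahedral_norm_on (lipschitz_free :: ('a lip0 \<Rightarrow>\<^sub>L real) set)"
    and "finite N" "0 < \<epsilon>"
  shows "\<exists>u v. u \<noteq> v \<and> (\<forall>x\<in>N. \<forall>y\<in>N. (1 - \<epsilon>) * (dist x y + dist u v) \<le> dist x u + dist y v)"
proof (rule ccontr)
  assume "\<not> ?thesis"
  \<comment> \<open>The roles of \<open>u\<close> and \<open>v\<close> are swapped to suit the later
    estimate of a difference from \<open>v\<close> to \<open>u\<close> through \<open>x\<close> and
    \<open>y\<close>.\<close>
  then have fail: "\<exists>x\<in>N. \<exists>y\<in>N. dist x v + dist y u < (1 - \<epsilon>) * (dist x y + dist u v)"
    if "u \<noteq> v" for u v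
    using that by (metis dist_commute not_le)
  define P where "P = {p \<in> N \<times> N. fst p \<noteq> snd p}"
  have P: "finite P" using \<open>finite N\<close> by (auto simp: P_def)
  \<comment> \<open>Small enough that the total loss \<open>3 * \<eta> * card P\<close> stays below
    \<open>\<epsilon>\<close>; the added 1 covers an empty \<open>P\<close>.\<close>
  define \<eta> where "\<eta> = min \<epsilon> 1 / (4 * (real (card P) + 1))"
  have \<eta>: "0 < \<eta>" "3 * \<eta> \<le> \<epsilon>" "3 * \<eta> * card P < \<epsilon>" "\<eta> < 1"
  proof -
    have *: "\<eta> * (4 * (real (card P) + 1)) = min \<epsilon> 1"
      by (simp add: \<eta>_def)
    show "0 < \<eta>" using \<open>0 < \<epsilon>\<close> by (simp add: \<eta>_def)
    then have "0 \<le> \<eta> * card P" by simp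
    then show "3 * \<eta> \<le> \<epsilon>" "3 * \<eta> * card P < \<epsilon>" "\<eta> < 1"
      using * \<open>0 < \<eta>\<close> unfolding distrib_left distrib_right by linarith+
  qed
  define Y where "Y = span (free_delta ` N)"
  have "subspace Y" "\<exists>B. finite B \<and> Y = span B" "Y \<subseteq> lipschitz_free"
    using \<open>finite N\<close> span_mono[of "free_delta ` N" "range free_delta"] closure_subset
    unfolding Y_def lipschitz_free_def by blast+
  then obtain x where x: "norm x = 1"
      "\<And>y c. y \<in> Y \<Longrightarrow> (1 - \<eta>) * (norm y + \<bar>c\<bar>) \<le> norm (y + c *\<^sub>R x)"
    using oct \<eta>(1) unfolding octahedral_norm_on_def by metis
  have "\<exists>f. norm f \<le> 1 \<and> 1 - 3 * \<eta> \<le> blinfun_apply x f \<and>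
      (1 - 3 * \<eta>) * dist (fst p) (snd p) \<le> lip0_apply f (fst p) - lip0_apply f (snd p)"
    if "p \<in> P" for p
  proof -
    let ?m = "molecule (fst p) (snd p)"
    have p: "fst p \<in> N" "snd p \<in> N" "fst p \<noteq> snd p" using that by (auto simp: P_def)
    have m: "norm ?m = 1" "?m \<in> Y"
      using p by (auto simp: norm_molecule Y_def intro: molecule_in_span)
    \<comment> \<open>Octahedrality at the molecule with coefficient 1. A function whose two values
      sum to more than \<open>2 - 3 * \<eta>\<close>, each being at most 1, has both above
      \<open>1 - 3 * \<eta>\<close>.\<close>
    have "(1 - \<eta>) * 2 \<le> norm (?m + x)"
      using x(2)[OF m(2), of 1] m(1) by simp
    then have "max 0 (2 - 3 * \<eta>) < norm (?m + x)"
      using \<eta> by auto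
    then obtain f where f: "norm f \<le> 1" "max 0 (2 - 3 * \<eta>) < blinfun_apply (?m + x) f"
      using blinfun_norm_approx by (metis max.cobounded1)
    have "blinfun_apply ?m f \<le> 1" "blinfun_apply x f \<le> 1"
      using blinfun_apply_le[of ?m f] blinfun_apply_le[of x f] f(1) m(1) x(1) by auto
    with f(2) have *: "1 - 3 * \<eta> \<le> blinfun_apply x f" "1 - 3 * \<eta> \<le> blinfun_apply ?m f"
      by (simp_all add: blinfun.add_left)
    have "(1 - 3 * \<eta>) * dist (fst p) (snd p) \<le> lip0_apply f (fst p) - lip0_apply f (snd p)"
      using *(2) p(3) by (simp add: molecule_apply pos_le_divide_eq)
    with *(1) f(1) show ?thesis by blast
  qed
  then obtain f where f: "\<And>p. p \<in> P \<Longrightarrow> norm (f p) \<le> 1" "\<And>p. p \<in> P \<Longrightarrow> 1 - 3 * \<eta> \<le> blinfun_apply x (f p)"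
      "\<And>p. p \<in> P \<Longrightarrow> (1 - 3 * \<eta>) * dist (fst p) (snd p) \<le> lip0_apply (f p) (fst p) - lip0_apply (f p) (snd p)"
    by metis
  have f_lip: "lip0_apply (f p) a - lip0_apply (f p) b \<le> dist a b" if "p \<in> P" for p a b
    using lip0_lipschitz[of "f p" a b] mult_right_mono[OF f(1)[OF that], of "dist a b"] by simp
  define g where "g = (\<Sum>p\<in>P. f p)"
  \<comment> \<open>One summand, chosen according to \<open>u\<close> and \<open>v\<close>,
    contributes at most \<open>(1 - \<epsilon>) * dist u v\<close>; each other one at most
    \<open>dist u v\<close>.\<close>
  have g_less: "lip0_apply g u - lip0_apply g v \<le> (card P - \<epsilon>) * dist u v" if neq: "u \<noteq> v" for u v
  proof -
    obtain x y where xy: "x \<in> N" "y \<in> N"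
        "dist x v + dist y u < (1 - \<epsilon>) * (dist x y + dist u v)"
      using fail[OF neq] by blast
    \<comment> \<open>A failing pair with equal points would contradict the triangle inequality, so
      the pair lies in \<open>P\<close>.\<close>
    have "x \<noteq> y"
    proof
      assume "x = y"
      then have "dist u v < (1 - \<epsilon>) * dist u v"
        using xy(3) dist_triangle3[of u v x] by simp
      moreover have "0 \<le> \<epsilon> * dist u v" using \<open>0 < \<epsilon>\<close> by simp
      ultimately show False by (simp add: algebra_simps)
    qed
    define p where "p = (x, y)"
    have p: "p \<in> P" using xy \<open>x \<noteq> y\<close> by (auto simp: P_def p_def)
    have "3 * \<eta> * dist x y \<le> \<epsilon> * dist x y" using \<eta>(2) by (intro mult_right_mono) auto
    \<comment> \<open>Split the difference as \<open>u\<close> to \<open>y\<close>, minus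
      \<open>x\<close> to \<open>y\<close>, plus \<open>x\<close> to \<open>v\<close>. The middle
      term is almost \<open>dist x y\<close>, and \<open>3 * \<eta> \<le> \<epsilon>\<close> absorbs
      the defect.\<close>
    then have "lip0_apply (f p) u - lip0_apply (f p) v \<le> (1 - \<epsilon>) * dist u v"
      using f(3)[OF p] f_lip[OF p, of u y] f_lip[OF p, of x v] xy(3)
      by (simp add: p_def algebra_simps dist_commute)
    moreover have "(\<Sum>q\<in>P - {p}. lip0_apply (f q) u - lip0_apply (f q) v)
        \<le> (\<Sum>q\<in>P - {p}. dist u v)"
      by (intro sum_mono f_lip) auto
    moreover have "(\<Sum>q\<in>P. dist u v) = dist u v + (\<Sum>q\<in>P - {p}. dist u v)"
      by (rule sum.remove[OF P p])
    ultimately have "(\<Sum>q\<in>P. lip0_apply (f q) u - lip0_apply (f q) v) \<le> (card P - \<epsilon>) * dist u v"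
      by (simp add: sum.remove[OF P p] algebra_simps)
    then show ?thesis by (simp add: g_def lip0_apply_sum sum_subtractf)
  qed
  have g_le: "\<bar>lip0_apply g u - lip0_apply g v\<bar> \<le> (card P - \<epsilon>) * dist u v" for u v
    using g_less[of u v] g_less[of v u] by (cases "u = v") (auto simp: dist_commute)
  \<comment> \<open>The norm bound needs a nonnegative constant. A nonzero functional forces a point
    besides the base point, and the estimate at these two points gives the sign.\<close>
  obtain h where "0 < blinfun_apply x h"
    using blinfun_norm_approx[of 0 x] x(1) by auto
  then have "h \<noteq> 0" by auto
  then obtain z where "lip0_apply h z \<noteq> lip0_apply 0 z"
    by (metis ext lip0_apply_inject)
  then have "z \<noteq> basepoint" by auto
  then have "0 \<le> real (card P) - \<epsilon>"
    using order_trans[OF abs_ge_zero g_le[of z basepoint]] by (simp add: zero_le_mult_iff)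
  then have "norm g \<le> card P - \<epsilon>"
    using g_le by (rule norm_lip0_le)
  then have "blinfun_apply x g \<le> card P - \<epsilon>"
    using blinfun_apply_le[of x g] x(1) by simp
  moreover have "(\<Sum>p\<in>P. 1 - 3 * \<eta>) \<le> blinfun_apply x g"
    unfolding g_def blinfun.sum_right by (intro sum_mono f(2))
  ultimately show False
    using \<eta>(3) by (simp add: algebra_simps)
qed

section \<open>Extension from a finite set by minima of cones\<close>

lemma lipschitz_on_Min:
  fixes h :: "'i \<Rightarrow> 'b::metric_space \<Rightarrow> real"
  assumes "finite I" "I \<noteq> {}" "0 \<le> L" "\<And>i. i \<in> I \<Longrightarrow> L-lipschitz_on X (h i)"
  shows "L-lipschitz_on X (\<lambda>z. Min ((\<lambda>i. h i z) ` I))"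
proof (rule lipschitz_onI)
  have le: "Min ((\<lambda>i. h i z) ` I) \<le> Min ((\<lambda>i. h i w) ` I) + L * dist z w"
    if "z \<in> X" "w \<in> X" for z w
  proof -
    have "Min ((\<lambda>i. h i w) ` I) \<in> (\<lambda>i. h i w) ` I" using assms by simp
    then obtain i where i: "i \<in> I" "Min ((\<lambda>i. h i w) ` I) = h i w" by blast
    have "Min ((\<lambda>i. h i z) ` I) \<le> h i z" using assms i by simp
    moreover have "\<bar>h i z - h i w\<bar> \<le> L * dist z w"
      using lipschitz_onD[OF assms(4)[OF i(1)] that] by (simp add: dist_real_def)
    ultimately show ?thesis using i by linarith
  qed
  show "dist (Min ((\<lambda>i. h i z) ` I)) (Min ((\<lambda>i. h i w) ` I)) \<le> L * dist z w"
    if "z \<in> X" "w \<in> X" for z w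
    using le[OF that] le[OF that(2,1)] by (simp add: dist_real_def dist_commute)
qed fact

text \<open>The cone \<open>k\<close> at \<open>v\<close> has \<open>k v = h u - dist u v\<close>,
  while \<open>k u \<ge> h u\<close> because \<open>L \<ge> 1\<close>; so the minimum drops by at
  least \<open>dist u v\<close> from \<open>u\<close> to \<open>v\<close>. The distance hypothesis
  keeps \<open>k\<close> above \<open>f\<close> on \<open>N\<close>.\<close>

lemma extension_of_distance:
  fixes N :: "'b::metric_space set" and f :: "'b \<Rightarrow> real"
  assumes "finite N" "N \<noteq> {}" "1 \<le> L" and f: "1-lipschitz_on N f"
    and uv: "\<And>x y. x \<in> N \<Longrightarrow> y \<in> N \<Longrightarrow> dist x y + dist u v \<le> L * (dist x u + dist y v)"
  shows "\<exists>g. (\<forall>x\<in>N. g x = f x) \<and> L-lipschitz_on UNIV g \<and> g u - g v \<ge> dist u v"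
proof -
  define h where "h z = Min ((\<lambda>x. f x + L * dist x z) ` N)" for z
  define k where "k z = (h u - dist u v) + L * dist v z" for z
  \<comment> \<open>Indexing by booleans lets the lemma on minima of families serve for two
    functions.\<close>
  define g where "g z = Min ((\<lambda>b. (if b then h else k) z) ` UNIV)" for z
  have g: "g z = min (h z) (k z)" for z
    by (simp add: g_def UNIV_bool min.commute)
  have f_le: "f x \<le> f y + dist x y" if "x \<in> N" "y \<in> N" for x y
    using lipschitz_onD[OF f that] by (simp add: dist_real_def)
  have h_eq: "h x = f x" if "x \<in> N" for x
    unfolding h_def
  proof (rule Min_eqI)
    fix t assume "t \<in> (\<lambda>y. f y + L * dist y x) ` N"
    then obtain y where y: "y \<in> N" "t = f y + L * dist y x" by blast
    have "1 * dist y x \<le> L * dist y x" using \<open>1 \<le> L\<close> by (intro mult_right_mono) auto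
    then show "f x \<le> t" using f_le[OF that y(1)] y(2) by (simp add: dist_commute)
  qed (use that assms in \<open>auto intro: rev_image_eqI\<close>)
  have k_ge: "f y \<le> k y" if "y \<in> N" for y
  proof -
    \<comment> \<open>The distance hypothesis is applied at the point \<open>x\<close> whose cone
      attains the minimum \<open>h u\<close>.\<close>
    have "h u \<in> (\<lambda>x. f x + L * dist x u) ` N"
      unfolding h_def using assms by (intro Min_in) auto
    then obtain x where x: "x \<in> N" "h u = f x + L * dist x u" by blast
    show ?thesis
      using f_le[OF that x(1)] uv[OF x(1) that] x(2)
      by (simp add: k_def distrib_left dist_commute)
  qed
  have "L-lipschitz_on UNIV h"
    unfolding h_def using assms by (intro lipschitz_on_Min lipschitz_on_cone) auto
  moreover have "L-lipschitz_on UNIV k"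
    unfolding k_def using assms by (intro lipschitz_on_cone) auto
  ultimately have "L-lipschitz_on UNIV g"
    unfolding g_def using \<open>1 \<le> L\<close> by (intro lipschitz_on_Min) auto
  moreover have "dist u v \<le> L * dist u v"
    using mult_right_mono[OF \<open>1 \<le> L\<close>, of "dist u v"] by simp
  then have "g u - g v \<ge> dist u v"
    by (simp add: g k_def dist_commute)
  moreover have "\<forall>x\<in>N. g x = f x"
    using h_eq k_ge by (simp add: g)
  ultimately show ?thesis by blast
qed

theorem theorem3p1:
  defines "octahedral_free \<equiv>
      octahedral_norm_on (lipschitz_free :: ('a::pointed_metric_space lip0 \<Rightarrow>\<^sub>L real) set)"
    and "extension_property \<equiv>
      (\<forall>\<epsilon>>0. \<forall>N :: 'a set. finite N \<longrightarrow>
        (\<exists>u v. u \<noteq> v \<and>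
          (\<forall>f :: 'a \<Rightarrow> real. 1-lipschitz_on N f \<longrightarrow>
            (\<exists>g :: 'a \<Rightarrow> real. (\<forall>x\<in>N. g x = f x) \<and> (1 + \<epsilon>)-lipschitz_on UNIV g \<and>
              g u - g v \<ge> dist u v))))"
    and "distance_property \<equiv>
      (\<forall>N :: 'a set. \<forall>\<epsilon>>0. finite N \<longrightarrow>
        (\<exists>u v. u \<noteq> v \<and>
          (\<forall>x\<in>N. \<forall>y\<in>N. (1 - \<epsilon>) * (dist x y + dist u v) \<le> dist x u + dist y v)))"
  shows "(octahedral_free \<longleftrightarrow> extension_property) \<and>
         (extension_property \<longleftrightarrow> distance_property)"
proof -
  \<comment> \<open>Both equivalences follow from the cycle distance, extension, octahedrality,
    distance.\<close>
  have "extension_property" if dp: "distance_property"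
    unfolding extension_property_def
  proof (intro allI impI)
    fix \<epsilon> :: real and N :: "'a set"
    assume "0 < \<epsilon>" "finite N"
    \<comment> \<open>A minimum of cones needs a nonempty set; on a single point every function is
      1-Lipschitz.\<close>
    define N' where "N' = (if N = {} then {basepoint} else N)"
    have N': "finite N'" "N' \<noteq> {}" using \<open>finite N\<close> by (auto simp: N'_def)
    \<comment> \<open>With \<open>\<epsilon> / (1 + \<epsilon>)\<close> as tolerance, multiplying by
      \<open>1 + \<epsilon>\<close> turns the factor on the left into 1.\<close>
    have \<epsilon>': "0 < \<epsilon> / (1 + \<epsilon>)" "(1 + \<epsilon>) * (1 - \<epsilon> / (1 + \<epsilon>)) = 1"
      using \<open>0 < \<epsilon>\<close> by (auto simp: field_simps)
    obtain u v where uv: "u \<noteq> v" "\<And>x y. x \<in> N' \<Longrightarrow> y \<in> N' \<Longrightarrow>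
        (1 - \<epsilon> / (1 + \<epsilon>)) * (dist x y + dist u v) \<le> dist x u + dist y v"
      using dp[unfolded distance_property_def, rule_format, OF \<epsilon>'(1) N'(1)] by blast
    have "dist x y + dist u v \<le> (1 + \<epsilon>) * (dist x u + dist y v)" if "x \<in> N'" "y \<in> N'" for x y
      using mult_left_mono[OF uv(2)[OF that], of "1 + \<epsilon>"] \<open>0 < \<epsilon>\<close> \<epsilon>'(2)
      by (simp only: mult.assoc[symmetric]) simp
    moreover have "1-lipschitz_on N' f" if "1-lipschitz_on N f" for f :: "'a \<Rightarrow> real"
      using that by (auto simp: N'_def)
    ultimately have ext: "\<exists>g. (\<forall>x\<in>N'. g x = f x) \<and> (1 + \<epsilon>)-lipschitz_on UNIV g \<and>
        g u - g v \<ge> dist u v" if "1-lipschitz_on N f" for f :: "'a \<Rightarrow> real"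
      using extension_of_distance[OF N', of "1 + \<epsilon>" f u v] that \<open>0 < \<epsilon>\<close> by simp
    have sub: "N \<subseteq> N'" by (auto simp: N'_def)
    show "\<exists>u v. u \<noteq> v \<and>
          (\<forall>f :: 'a \<Rightarrow> real. 1-lipschitz_on N f \<longrightarrow>
            (\<exists>g :: 'a \<Rightarrow> real. (\<forall>x\<in>N. g x = f x) \<and> (1 + \<epsilon>)-lipschitz_on UNIV g \<and>
              g u - g v \<ge> dist u v))"
    proof (rule exI[of _ u], rule exI[of _ v], intro conjI allI impI)
      fix f :: "'a \<Rightarrow> real"
      assume "1-lipschitz_on N f"
      from ext[OF this] obtain g where g: "\<forall>x\<in>N'. g x = f x"
        "(1 + \<epsilon>)-lipschitz_on UNIV g \<and> g u - g v \<ge> dist u v" by (elim exE conjE) simp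
      from g(1) sub have "\<forall>x\<in>N. g x = f x" by blast
      with g(2) show "\<exists>g. (\<forall>x\<in>N. g x = f x) \<and> (1 + \<epsilon>)-lipschitz_on UNIV g \<and>
          g u - g v \<ge> dist u v"
        by (intro exI[of _ g] conjI) simp_all
    qed fact
  qed
  moreover have "distance_property" if "octahedral_free"
    unfolding distance_property_def
    using distance_of_octahedral[OF that[unfolded octahedral_free_def]] by simp
  moreover have "octahedral_free" if "extension_property"
    unfolding octahedral_free_def
    by (rule octahedral_of_extension) (use that[unfolded extension_property_def] in simp)
  ultimately show ?thesis by blast
qed

end
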